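(* Let $d\in\mathbb{N}$, let $\mathcal{Y}\subseteq\mathbb{P}^d$ be the Pareto moment variety and let $\mathcal{X}\subseteq\mathbb{P}^d$ be the moment variety of first order local mixtures of Dirac measures (that is, the tangent variety of the Veronese curve), both over $\mathbb{C}$. Then $\mathcal{X}$ and $\mathcal{Y}$ are birationally equivalent via the rational map $$\psi\colon\mathbb{P}^d\dashrightarrow\mathbb{P}^d,\qquad [m_0:\cdots:m_d]\longmapsto[m_0^{-1}:\cdots:m_d^{-1}].$$
   Context: $\mathbb{P}^d$ is projective space over $\mathbb{C}$. The Pareto moment variety is $\mathcal{Y}=\overline{\operatorname{im}(\rho)}$ (Zariski closure), where $\rho\colon(\mathbb{C}\setminus\{0,\dots,d\})\times\mathbb{C}^{\times}\to\mathbb{P}^d$, $\rho(\alpha,\xi)=\left[\frac{\alpha}{\alpha-i}\xi^i\right]_{0\le i\le d}$. The variety $\mathcal{X}$ is the Zariski closure of the set of points $[m_0:\cdots:m_d]$ with $m_0=1$, $m_i=\xi^i+i\alpha\xi^{i-1}$ for $1\le i\le d$, where $(\xi,\alpha)\in\mathbb{C}^2$. *)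

theory Defs
  imports "HOL-Analysis.Analysis" "HOL-Library.Poly_Mapping"
begin

text \<open>Complex projective \<open>d\<close>-space. Homogeneous coordinate vectors are functions on the naturals supported on the
  indices \<open>0, \<dots>, d\<close>; a point is a class of nonzero vectors modulo scaling.\<close>

definition homog_vec :: "nat \<Rightarrow> (nat \<Rightarrow> complex) set" where
  "homog_vec d = {v. (\<forall>i>d. v i = 0) \<and> (\<exists>i\<le>d. v i \<noteq> 0)}"

definition proj_rel :: "nat \<Rightarrow> ((nat \<Rightarrow> complex) \<times> (nat \<Rightarrow> complex)) set" where
  "proj_rel d = {(v, w). v \<in> homog_vec d \<and> w \<in> homog_vec d \<and> (\<exists>c. c \<noteq> 0 \<and> w = (\<lambda>i. c * v i))}"

definition proj_space :: "nat \<Rightarrow> (nat \<Rightarrow> complex) set set" where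
  "proj_space d = homog_vec d // proj_rel d"

text \<open>The point \<open>[m 0 : \<dots> : m d]\<close>. It is the empty set, hence no point of the projective
  space, if \<open>m 0, \<dots>, m d\<close> all vanish.\<close>

definition pt :: "nat \<Rightarrow> (nat \<Rightarrow> complex) \<Rightarrow> (nat \<Rightarrow> complex) set" where
  "pt d m = proj_rel d `` {\<lambda>i. if i \<le> d then m i else 0}"

lemma equiv_proj_rel: "equiv (homog_vec d) (proj_rel d)"
proof (rule equivI)
  show "proj_rel d \<subseteq> homog_vec d \<times> homog_vec d"
    by (auto simp: proj_rel_def)
  show "refl_on (homog_vec d) (proj_rel d)"
    unfolding refl_on_def proj_rel_def by (auto intro: exI[of _ 1])
  show "sym (proj_rel d)"
  proof (rule symI)
    fix v w assume "(v, w) \<in> proj_rel d"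
    then obtain c where c: "v \<in> homog_vec d" "w \<in> homog_vec d" "c \<noteq> 0" "w = (\<lambda>i. c * v i)"
      by (auto simp: proj_rel_def)
    then have "v = (\<lambda>i. inverse c * w i)" by auto
    moreover have "inverse c \<noteq> 0" using c(3) by simp
    ultimately show "(w, v) \<in> proj_rel d"
      unfolding proj_rel_def using c(1,2) by blast
  qed
  show "trans (proj_rel d)"
  proof (rule transI)
    fix u v w assume "(u, v) \<in> proj_rel d" "(v, w) \<in> proj_rel d"
    then obtain a b where c: "u \<in> homog_vec d" "w \<in> homog_vec d" "a \<noteq> 0" "b \<noteq> 0"
      "v = (\<lambda>i. a * u i)" "w = (\<lambda>i. b * v i)"
      by (auto simp: proj_rel_def)
    then have "w = (\<lambda>i. (b * a) * u i)" by (simp add: mult.assoc)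
    moreover have "b * a \<noteq> 0" using c(3,4) by simp
    ultimately show "(u, w) \<in> proj_rel d"
      unfolding proj_rel_def using c(1,2) by blast
  qed
qed

lemma pt_in_proj_space: "\<exists>i\<le>d. m i \<noteq> 0 \<Longrightarrow> pt d m \<in> proj_space d"
  unfolding pt_def proj_space_def by (rule quotientI) (auto simp: homog_vec_def)

lemma pt_eq_iff:
  assumes "\<exists>i\<le>d. m i \<noteq> 0" "\<exists>i\<le>d. n i \<noteq> 0"
  shows "pt d m = pt d n \<longleftrightarrow> (\<exists>c. c \<noteq> 0 \<and> (\<forall>i\<le>d. n i = c * m i))"
proof -
  let ?m = "\<lambda>i. if i \<le> d then m i else 0" and ?n = "\<lambda>i. if i \<le> d then n i else 0"
  have v: "?m \<in> homog_vec d" "?n \<in> homog_vec d"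
    using assms by (auto simp: homog_vec_def)
  have "pt d m = pt d n \<longleftrightarrow> (?m, ?n) \<in> proj_rel d"
    unfolding pt_def using eq_equiv_class_iff[OF equiv_proj_rel v] .
  also have "\<dots> \<longleftrightarrow> (\<exists>c. c \<noteq> 0 \<and> ?n = (\<lambda>i. c * ?m i))"
    using v unfolding proj_rel_def by blast
  also have "\<dots> \<longleftrightarrow> (\<exists>c. c \<noteq> 0 \<and> (\<forall>i\<le>d. n i = c * m i))"
  proof (intro ex_cong1 conj_cong refl)
    fix c show "?n = (\<lambda>i. c * ?m i) \<longleftrightarrow> (\<forall>i\<le>d. n i = c * m i)"
      unfolding fun_eq_iff by (auto split: if_splits)
  qed
  finally show ?thesis .
qed

text \<open>Polynomials in the variables \<open>x 0, x 1, \<dots>\<close>: finitely supported maps from exponent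
  vectors to coefficients.\<close>

type_synonym cpoly = "(nat \<Rightarrow>\<^sub>0 nat) \<Rightarrow>\<^sub>0 complex"

definition meval :: "(nat \<Rightarrow>\<^sub>0 nat) \<Rightarrow> (nat \<Rightarrow> complex) \<Rightarrow> complex" where
  "meval m v = (\<Prod>i\<in>Poly_Mapping.keys m. v i ^ Poly_Mapping.lookup m i)"

definition peval :: "cpoly \<Rightarrow> (nat \<Rightarrow> complex) \<Rightarrow> complex" where
  "peval f v = (\<Sum>m\<in>Poly_Mapping.keys f. Poly_Mapping.lookup f m * meval m v)"

definition mdegree :: "(nat \<Rightarrow>\<^sub>0 nat) \<Rightarrow> nat" where
  "mdegree m = (\<Sum>i\<in>Poly_Mapping.keys m. Poly_Mapping.lookup m i)"

definition form :: "nat \<Rightarrow> nat \<Rightarrow> cpoly \<Rightarrow> bool" where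
  "form d k f \<longleftrightarrow> (\<forall>m\<in>Poly_Mapping.keys f. Poly_Mapping.keys m \<subseteq> {..d} \<and> mdegree m = k)"

definition zero_locus :: "nat \<Rightarrow> cpoly set \<Rightarrow> (nat \<Rightarrow> complex) set set" where
  "zero_locus d S = {p \<in> proj_space d. \<forall>f\<in>S. \<forall>v\<in>p. peval f v = 0}"

definition zariski :: "nat \<Rightarrow> (nat \<Rightarrow> complex) set topology" where
  "zariski d = topology (\<lambda>U. \<exists>S. (\<forall>f\<in>S. \<exists>k. form d k f) \<and> U = proj_space d - zero_locus d S)"

lemma meval_superset:
  "finite A \<Longrightarrow> Poly_Mapping.keys m \<subseteq> A \<Longrightarrow> meval m v = (\<Prod>i\<in>A. v i ^ Poly_Mapping.lookup m i)"
  unfolding meval_def by (rule prod.mono_neutral_left) (auto simp: in_keys_iff)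

lemma mdegree_superset:
  "finite A \<Longrightarrow> Poly_Mapping.keys m \<subseteq> A \<Longrightarrow> mdegree m = (\<Sum>i\<in>A. Poly_Mapping.lookup m i)"
  unfolding mdegree_def by (rule sum.mono_neutral_left) (auto simp: in_keys_iff)

lemma peval_superset:
  "finite A \<Longrightarrow> Poly_Mapping.keys f \<subseteq> A \<Longrightarrow> peval f v = (\<Sum>m\<in>A. Poly_Mapping.lookup f m * meval m v)"
  unfolding peval_def by (rule sum.mono_neutral_left) (auto simp: in_keys_iff)

lemma meval_add: "meval (m + n) v = meval m v * meval n v"
proof -
  let ?A = "Poly_Mapping.keys m \<union> Poly_Mapping.keys n"
  have "Poly_Mapping.keys (m + n) \<subseteq> ?A" by (rule keys_add)
  then show ?thesis
    by (simp add: meval_superset[where A = ?A] lookup_add power_add prod.distrib)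
qed

lemma mdegree_add: "mdegree (m + n) = mdegree m + mdegree n"
proof -
  let ?A = "Poly_Mapping.keys m \<union> Poly_Mapping.keys n"
  have "Poly_Mapping.keys (m + n) \<subseteq> ?A" by (rule keys_add)
  then show ?thesis
    by (simp add: mdegree_superset[where A = ?A] lookup_add sum.distrib)
qed

lemma peval_zero [simp]: "peval 0 v = 0"
  by (simp add: peval_def)

lemma peval_single [simp]: "peval (Poly_Mapping.single m c) v = c * meval m v"
  by (cases "c = 0") (simp_all add: peval_def)

lemma peval_one [simp]: "peval 1 v = 1"
  unfolding single_one[symmetric] peval_single by (simp add: meval_def)

lemma peval_add: "peval (f + g) v = peval f v + peval g v"
proof -
  let ?A = "Poly_Mapping.keys f \<union> Poly_Mapping.keys g"
  have "Poly_Mapping.keys (f + g) \<subseteq> ?A" by (rule keys_add)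
  then show ?thesis
    by (simp add: peval_superset[where A = ?A] lookup_add sum.distrib distrib_right)
qed

lemma peval_sum: "peval (\<Sum>x\<in>A. f x) v = (\<Sum>x\<in>A. peval (f x) v)"
  by (induction A rule: infinite_finite_induct) (simp_all add: peval_add)

lemma cpoly_monomials:
  fixes f :: cpoly
  shows "f = (\<Sum>m\<in>Poly_Mapping.keys f. Poly_Mapping.single m (Poly_Mapping.lookup f m))"
proof (rule poly_mapping_eqI)
  fix k
  have "Poly_Mapping.lookup
      (\<Sum>m\<in>Poly_Mapping.keys f. Poly_Mapping.single m (Poly_Mapping.lookup f m)) k
    = (\<Sum>m\<in>Poly_Mapping.keys f. if m = k then Poly_Mapping.lookup f m else 0)"
    by (simp only: lookup_sum lookup_single when_def)
  also have "\<dots> = (if k \<in> Poly_Mapping.keys f then Poly_Mapping.lookup f k else 0)"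
    by (rule sum.delta) (rule finite_keys)
  also have "\<dots> = Poly_Mapping.lookup f k"
    by (simp add: in_keys_iff)
  finally show "Poly_Mapping.lookup f k = Poly_Mapping.lookup
      (\<Sum>m\<in>Poly_Mapping.keys f. Poly_Mapping.single m (Poly_Mapping.lookup f m)) k"
    by (rule sym)
qed

lemma peval_mult: "peval (f * g) v = peval f v * peval g v"
proof -
  have "f * g = (\<Sum>m\<in>Poly_Mapping.keys f. \<Sum>n\<in>Poly_Mapping.keys g.
      Poly_Mapping.single (m + n) (Poly_Mapping.lookup f m * Poly_Mapping.lookup g n))"
    using arg_cong2[where f = times, OF cpoly_monomials[of f] cpoly_monomials[of g]]
    by (simp only: sum_product mult_single)
  then show ?thesis
    by (simp add: peval_sum meval_add)
       (simp add: peval_def sum_product mult.assoc mult.left_commute)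
qed

lemma form_mult:
  assumes "form d k f" "form d l g"
  shows "form d (k + l) (f * g)"
  unfolding form_def
proof
  fix m assume "m \<in> Poly_Mapping.keys (f * g)"
  then obtain a b where ab: "a \<in> Poly_Mapping.keys f" "b \<in> Poly_Mapping.keys g" "m = a + b"
    using keys_mult[of f g] by blast
  have "Poly_Mapping.keys a \<subseteq> {..d}" "Poly_Mapping.keys b \<subseteq> {..d}" "mdegree a = k" "mdegree b = l"
    using assms ab by (simp_all add: form_def)
  then show "Poly_Mapping.keys m \<subseteq> {..d} \<and> mdegree m = k + l"
    using keys_add[of a b] ab(3) mdegree_add[of a b] by blast
qed

lemma form_one: "form d 0 1"
  by (simp add: form_def mdegree_def)

lemma peval_scale:
  assumes "form d k f"
  shows "peval f (\<lambda>i. c * v i) = c ^ k * peval f v"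
  unfolding peval_def sum_distrib_left
proof (rule sum.cong)
  fix m assume "m \<in> Poly_Mapping.keys f"
  then have "mdegree m = k" using assms by (simp add: form_def)
  then have "meval m (\<lambda>i. c * v i) = c ^ k * meval m v"
    by (auto simp: meval_def mdegree_def power_mult_distrib prod.distrib power_sum)
  then show "Poly_Mapping.lookup f m * meval m (\<lambda>i. c * v i)
      = c ^ k * (Poly_Mapping.lookup f m * meval m v)"
    by simp
qed simp

lemma form_vanish_iff:
  assumes "form d k f" "p \<in> proj_space d" "v \<in> p" "w \<in> p"
  shows "peval f v = 0 \<longleftrightarrow> peval f w = 0"
proof -
  have "(v, w) \<in> proj_rel d"
    using assms(2-4) quotient_eq_iff[OF equiv_proj_rel, of p d p v w]
    by (simp add: proj_space_def)
  then obtain c where "c \<noteq> 0" "w = (\<lambda>i. c * v i)"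
    by (auto simp: proj_rel_def)
  then show ?thesis using peval_scale[OF assms(1)] by simp
qed

lemma istopology_zariski:
  "istopology (\<lambda>U. \<exists>S. (\<forall>f\<in>S. \<exists>k. form d k f) \<and> U = proj_space d - zero_locus d S)"
  (is "istopology ?L")
  unfolding istopology_def
proof (intro conjI allI impI)
  fix U V assume "?L U" "?L V"
  from \<open>?L U\<close> obtain S where S: "\<forall>f\<in>S. \<exists>k. form d k f" "U = proj_space d - zero_locus d S"
    by (elim exE conjE)
  from \<open>?L V\<close> obtain T where T: "\<forall>f\<in>T. \<exists>k. form d k f" "V = proj_space d - zero_locus d T"
    by (elim exE conjE)
  let ?R = "{f * g |f g. f \<in> S \<and> g \<in> T}"
  have "zero_locus d ?R = zero_locus d S \<union> zero_locus d T" (is "?A = ?B")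
  proof
    show "?B \<subseteq> ?A" by (auto simp: zero_locus_def peval_mult)
    show "?A \<subseteq> ?B"
    proof
      fix p assume p: "p \<in> ?A"
      show "p \<in> ?B"
      proof (rule ccontr)
        assume "p \<notin> ?B"
        with p obtain f g v w where *: "f \<in> S" "g \<in> T" "v \<in> p" "w \<in> p"
          "peval f v \<noteq> 0" "peval g w \<noteq> 0"
          by (auto simp: zero_locus_def)
        obtain k where "form d k g" using T(1) \<open>g \<in> T\<close> by blast
        moreover have "p \<in> proj_space d" using p by (simp add: zero_locus_def)
        ultimately have "peval g v \<noteq> 0"
          using form_vanish_iff[of d k g p v w] * by blast
        moreover have "peval (f * g) v = 0"
          using p * unfolding zero_locus_def by blast
        ultimately show False using * by (simp add: peval_mult)
      qed
    qed
  qed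
  then have "U \<inter> V = proj_space d - zero_locus d ?R" unfolding S(2) T(2) by blast
  moreover have "\<forall>f\<in>?R. \<exists>k. form d k f" 
  proof
    fix h assume "h \<in> ?R"
    then obtain f g where "h = f * g" "f \<in> S" "g \<in> T" by blast
    with S(1) T(1) show "\<exists>k. form d k h" using form_mult by metis
  qed
  ultimately show "?L (U \<inter> V)" by blast
next
  fix K assume "\<forall>U\<in>K. ?L U"
  then obtain S where S: "\<forall>U\<in>K. (\<forall>f\<in>S U. \<exists>k. form d k f) \<and>
      U = proj_space d - zero_locus d (S U)"
    using bchoice[of K "\<lambda>U S. (\<forall>f\<in>S. \<exists>k. form d k f) \<and> U = proj_space d - zero_locus d S"]
    by blast
  have "\<Union>K = \<Union>((\<lambda>U. U) ` K)" by simp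
  also have "\<dots> = (\<Union>U\<in>K. proj_space d - zero_locus d (S U))"
    by (rule arg_cong[where f = Union], rule image_cong[OF refl]) (use S in blast)
  also have "\<dots> = proj_space d - zero_locus d (\<Union>U\<in>K. S U)"
    by (auto simp: zero_locus_def)
  finally have "\<Union>K = proj_space d - zero_locus d (\<Union>U\<in>K. S U)" .
  moreover have "\<forall>f\<in>(\<Union>U\<in>K. S U). \<exists>k. form d k f" using S by blast
  ultimately show "?L (\<Union>K)" by blast
qed

lemma openin_zariski:
  "openin (zariski d) U \<longleftrightarrow>
    (\<exists>S. (\<forall>f\<in>S. \<exists>k. form d k f) \<and> U = proj_space d - zero_locus d S)"
  unfolding zariski_def by (simp add: topology_inverse'[OF istopology_zariski])

lemma proj_class_nonempty: "p \<in> proj_space d \<Longrightarrow> p \<noteq> {}"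
  unfolding proj_space_def using in_quotient_imp_non_empty[OF equiv_proj_rel] by blast

lemma topspace_zariski: "topspace (zariski d) = proj_space d"
proof
  show "topspace (zariski d) \<subseteq> proj_space d"
    using openin_topspace[of "zariski d"] unfolding openin_zariski by blast
  have "zero_locus d {1} = {}"
    using proj_class_nonempty by (auto simp: zero_locus_def)
  then have "openin (zariski d) (proj_space d)"
    unfolding openin_zariski using form_one by (intro exI[of _ "{1}"]) auto
  then show "proj_space d \<subseteq> topspace (zariski d)" by (rule openin_subset)
qed

lemma closedin_zariski:
  "closedin (zariski d) Z \<longleftrightarrow> (\<exists>S. (\<forall>f\<in>S. \<exists>k. form d k f) \<and> Z = zero_locus d S)"
proof -
  have "zero_locus d S \<subseteq> proj_space d" for S by (auto simp: zero_locus_def)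
  then show ?thesis
    unfolding closedin_def topspace_zariski openin_zariski by blast
qed

text \<open>Locally on \<open>U\<close>, the map is given by forms of a common degree without common zero.\<close>

definition regular_map ::
    "nat \<Rightarrow> (nat \<Rightarrow> complex) set set \<Rightarrow> nat \<Rightarrow> ((nat \<Rightarrow> complex) set \<Rightarrow> (nat \<Rightarrow> complex) set) \<Rightarrow> bool"
  where
  "regular_map d U e f \<longleftrightarrow> U \<subseteq> proj_space d \<and>
    (\<forall>p\<in>U. \<exists>V k F. openin (zariski d) V \<and> p \<in> V \<and> (\<forall>i\<le>e. form d k (F i)) \<and>
      (\<forall>q\<in>U \<inter> V. \<forall>v\<in>q. (\<exists>i\<le>e. peval (F i) v \<noteq> 0) \<and> f q = pt e (\<lambda>i. peval (F i) v)))"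

text \<open>A rational map from \<open>X\<close> to \<open>Y\<close> is represented by a regular map \<open>f\<close> on a dense open
  subset \<open>U\<close> of \<open>X\<close> (for irreducible \<open>X\<close>, dense means nonempty). Values of \<open>f\<close> outside \<open>U\<close>
  are irrelevant.\<close>

definition rational_map ::
    "nat \<Rightarrow> (nat \<Rightarrow> complex) set set \<Rightarrow> nat \<Rightarrow> (nat \<Rightarrow> complex) set set \<Rightarrow>
     (nat \<Rightarrow> complex) set set \<Rightarrow> ((nat \<Rightarrow> complex) set \<Rightarrow> (nat \<Rightarrow> complex) set) \<Rightarrow> bool"
  where
  "rational_map d X e Y U f \<longleftrightarrow>
    openin (subtopology (zariski d) X) U \<and> X \<subseteq> zariski d closure_of U \<and>
    regular_map d U e f \<and> f ` U \<subseteq> Y"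

text \<open>There is a rational map \<open>g\<close> from \<open>Y\<close> to \<open>X\<close> such that both compositions are defined
  on a dense subset and are the identity there.\<close>

definition birational_map ::
    "nat \<Rightarrow> (nat \<Rightarrow> complex) set set \<Rightarrow> nat \<Rightarrow> (nat \<Rightarrow> complex) set set \<Rightarrow>
     (nat \<Rightarrow> complex) set set \<Rightarrow> ((nat \<Rightarrow> complex) set \<Rightarrow> (nat \<Rightarrow> complex) set) \<Rightarrow> bool"
  where
  "birational_map d X e Y U f \<longleftrightarrow> rational_map d X e Y U f \<and>
    (\<exists>V g. rational_map e Y d X V g \<and>
      X \<subseteq> zariski d closure_of {p \<in> U. f p \<in> V} \<and> (\<forall>p\<in>U. f p \<in> V \<longrightarrow> g (f p) = p) \<and>
      Y \<subseteq> zariski e closure_of {q \<in> V. g q \<in> U} \<and> (\<forall>q\<in>V. g q \<in> U \<longrightarrow> f (g q) = q))"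

definition pareto_param :: "nat \<Rightarrow> complex \<Rightarrow> complex \<Rightarrow> (nat \<Rightarrow> complex) set" where
  "pareto_param d \<alpha> \<xi> = pt d (\<lambda>i. \<alpha> / (\<alpha> - of_nat i) * \<xi> ^ i)"

definition pareto_variety :: "nat \<Rightarrow> (nat \<Rightarrow> complex) set set" where
  "pareto_variety d = zariski d closure_of
    {pareto_param d \<alpha> \<xi> |\<alpha> \<xi>. \<alpha> \<notin> of_nat ` {0..d} \<and> \<xi> \<noteq> 0}"

definition local_mixture_param :: "nat \<Rightarrow> complex \<Rightarrow> complex \<Rightarrow> (nat \<Rightarrow> complex) set" where
  "local_mixture_param d \<xi> \<alpha> =
    pt d (\<lambda>i. if i = 0 then 1 else \<xi> ^ i + of_nat i * \<alpha> * \<xi> ^ (i - 1))"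

definition local_mixture_variety :: "nat \<Rightarrow> (nat \<Rightarrow> complex) set set" where
  "local_mixture_variety d = zariski d closure_of {local_mixture_param d \<xi> \<alpha> |\<xi> \<alpha>. True}"

definition torus :: "nat \<Rightarrow> (nat \<Rightarrow> complex) set set" where
  "torus d = {p \<in> proj_space d. \<forall>v\<in>p. \<forall>i\<le>d. v i \<noteq> 0}"

text \<open>The class of the coordinatewise inverse does not depend on the representative
  \<open>v\<close> of \<open>p\<close>, so on the torus the union ranges over a single set; cf. \<open>psi_pt\<close>.\<close>

definition psi :: "nat \<Rightarrow> (nat \<Rightarrow> complex) set \<Rightarrow> (nat \<Rightarrow> complex) set" where
  "psi d p = (\<Union>v\<in>p. pt d (\<lambda>i. inverse (v i)))"

lemma psi_pt:
  assumes "\<forall>i\<le>d. m i \<noteq> 0"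
  shows "pt d m \<in> torus d" "psi d (pt d m) = pt d (\<lambda>i. inverse (m i))"
proof -
  have m: "pt d m \<in> proj_space d" using assms by (intro pt_in_proj_space) auto
  have c: "\<exists>c. c \<noteq> 0 \<and> (\<forall>i\<le>d. v i = c * m i)" if "v \<in> pt d m" for v
    using that by (auto simp: pt_def proj_rel_def)
  show "pt d m \<in> torus d"
    using c assms m by (fastforce simp: torus_def)
  have "pt d (\<lambda>i. inverse (v i)) = pt d (\<lambda>i. inverse (m i))" if v: "v \<in> pt d m" for v
  proof -
    obtain c where "c \<noteq> 0" "\<forall>i\<le>d. v i = c * m i" using c[OF v] by blast
    then show ?thesis using assms by (subst pt_eq_iff) (auto intro!: exI[of _ c])
  qed
  then show "psi d (pt d m) = pt d (\<lambda>i. inverse (m i))"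
    using proj_class_nonempty[OF m] unfolding psi_def by auto
qed

end

theory Submission
  imports Defs
begin

text \<open>Factor the local mixture coordinates as \<open>\<xi>\<^sup>i + i\<alpha>\<xi>\<^sup>i\<^sup>-\<^sup>1 = \<xi>\<^sup>i (1 + i\<alpha>/\<xi>)\<close> for \<open>\<xi> \<noteq> 0\<close>. Their
  inverses are \<open>\<xi>\<^sup>-\<^sup>i \<beta>/(\<beta> - i)\<close> with \<open>\<beta> = -\<xi>/\<alpha>\<close>, so inversion of the coordinates carries the local
  mixture with parameters \<open>(\<xi>, \<alpha>)\<close> to the Pareto point with parameters \<open>(\<beta>, 1/\<xi>)\<close>. In this way the
  generic local mixtures, those with \<open>\<alpha> \<noteq> 0\<close> and \<open>\<xi> + i\<alpha> \<noteq> 0\<close> for all \<open>i \<le> d\<close>, are mapped onto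
  all points that define the Pareto variety (\<open>psi_generic_local_mixtures\<close>).

  The rest is density and continuity. The generic local mixtures are dense among all of them,
  because an arbitrary one is the value at \<open>0\<close> of a continuous curve that is generic for all but
  finitely many parameters, and a form that vanishes on the rest of the curve vanishes there too
  (\<open>limit_in_closure\<close>). On the torus \<open>psi\<close> is an involution and is given by the forms
  \<open>\<Prod>\<^sub>j\<^sub>\<noteq>\<^sub>i x\<^sub>j\<close>, hence Zariski continuous (\<open>regular_map_closure\<close>), so the correspondence of the two
  dense sets extends to the parts of their closures that lie in the torus
  (\<open>birational_map_psi\<close>).\<close>

section \<open>Homogeneous coordinates\<close>

lemma mem_ptE:
  assumes "v \<in> pt d m"
  obtains c where "c \<noteq> 0" "v = (\<lambda>i. c * (if i \<le> d then m i else 0))" "v \<in> homog_vec d"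
  using assms by (auto simp: pt_def proj_rel_def)

lemma proj_space_rep:
  assumes "p \<in> proj_space d" "v \<in> p"
  shows "p = pt d v" "\<exists>i\<le>d. v i \<noteq> 0"
proof -
  obtain w where w: "p = proj_rel d `` {w}" "w \<in> homog_vec d"
    using assms(1) unfolding proj_space_def by (auto elim: quotientE)
  have wv: "(w, v) \<in> proj_rel d" using w assms(2) by simp
  then have v: "v \<in> homog_vec d" by (auto simp: proj_rel_def)
  then show "\<exists>i\<le>d. v i \<noteq> 0" by (auto simp: homog_vec_def)
  have "(\<lambda>i. if i \<le> d then v i else 0) = v"
    using v by (auto simp: homog_vec_def fun_eq_iff)
  then show "p = pt d v"
    using w(1) equiv_class_eq[OF equiv_proj_rel wv] by (simp add: pt_def)
qed

lemma peval_cong: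
  assumes "form d k f" "\<And>i. i \<le> d \<Longrightarrow> v i = w i"
  shows "peval f v = peval f w"
  unfolding peval_def
proof (rule sum.cong)
  fix m assume "m \<in> Poly_Mapping.keys f"
  then have "Poly_Mapping.keys m \<subseteq> {..d}" using assms(1) by (simp add: form_def)
  then have "meval m v = meval m w"
    unfolding meval_def by (intro prod.cong) (auto simp: assms(2))
  then show "Poly_Mapping.lookup f m * meval m v = Poly_Mapping.lookup f m * meval m w" by simp
qed simp

lemma vanishes_pt_iff:
  assumes "form d k f" "\<exists>i\<le>d. m i \<noteq> 0"
  shows "(\<forall>v\<in>pt d m. peval f v = 0) \<longleftrightarrow> peval f m = 0"
proof -
  let ?m = "\<lambda>i. if i \<le> d then m i else 0"
  have eq: "peval f ?m = peval f m" by (rule peval_cong[OF assms(1)]) simp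
  have "?m \<in> homog_vec d" using assms(2) by (auto simp: homog_vec_def)
  then have "?m \<in> pt d m" using equiv_class_self[OF equiv_proj_rel] by (simp add: pt_def)
  moreover have "peval f v = 0" if v: "v \<in> pt d m" and m: "peval f m = 0" for v
  proof -
    obtain c where "v = (\<lambda>i. c * ?m i)" using v by (elim mem_ptE)
    then show ?thesis using peval_scale[OF assms(1), of c ?m] eq m by simp
  qed
  ultimately show ?thesis using eq by metis
qed

section \<open>The algebra of forms\<close>

definition poly_var :: "nat \<Rightarrow> cpoly" where
  "poly_var j = Poly_Mapping.single (Poly_Mapping.single j 1) 1"

lemma peval_poly_var [simp]: "peval (poly_var j) v = v j"
  by (simp add: poly_var_def meval_def)

lemma form_poly_var: "j \<le> d \<Longrightarrow> form d 1 (poly_var j)"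
  by (simp add: poly_var_def form_def mdegree_def)

lemma form_sum:
  assumes "\<And>x. x \<in> A \<Longrightarrow> form d k (f x)"
  shows "form d k (\<Sum>x\<in>A. f x)"
  using assms
proof (induction A rule: infinite_finite_induct)
  case (insert x A)
  have "form d k (g + h)" if "form d k g" "form d k h" for g h
    using that keys_add[of g h] unfolding form_def by blast
  then show ?case using insert by simp
qed (simp_all add: form_def)

lemma form_const_mult: "form d k f \<Longrightarrow> form d k (Poly_Mapping.single 0 c * f)"
  using form_mult[of d 0 "Poly_Mapping.single 0 c" k f]
  by (simp add: form_def[of d 0] mdegree_def)

lemma form_power: "form d k f \<Longrightarrow> form d (k * n) (f ^ n)"
proof (induction n)
  case (Suc n)
  then show ?case using form_mult[of d k f "k * n" "f ^ n"] by simp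
qed (simp add: form_one)

lemma form_prod:
  "(\<And>x. x \<in> A \<Longrightarrow> form d (k x) (f x)) \<Longrightarrow> form d (\<Sum>x\<in>A. k x) (\<Prod>x\<in>A. f x)"
  by (induction A rule: infinite_finite_induct) (simp_all add: form_one form_mult)

lemma peval_power [simp]: "peval (f ^ n) v = peval f v ^ n"
  by (induction n) (simp_all add: peval_mult)

lemma peval_prod: "peval (\<Prod>x\<in>A. f x) v = (\<Prod>x\<in>A. peval (f x) v)"
  by (induction A rule: infinite_finite_induct) (simp_all add: peval_mult)

definition poly_subst :: "cpoly \<Rightarrow> (nat \<Rightarrow> cpoly) \<Rightarrow> cpoly" where
  "poly_subst f F = (\<Sum>m\<in>Poly_Mapping.keys f. Poly_Mapping.single 0 (Poly_Mapping.lookup f m) *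
     (\<Prod>i\<in>Poly_Mapping.keys m. F i ^ Poly_Mapping.lookup m i))"

lemma peval_poly_subst: "peval (poly_subst f F) v = peval f (\<lambda>i. peval (F i) v)"
  by (simp add: poly_subst_def peval_sum peval_mult peval_prod)
     (simp add: peval_def meval_def)

lemma form_poly_subst:
  assumes f: "form e l f" and F: "\<And>i. i \<le> e \<Longrightarrow> form d k (F i)"
  shows "form d (k * l) (poly_subst f F)"
  unfolding poly_subst_def
proof (intro form_sum form_const_mult)
  fix m assume "m \<in> Poly_Mapping.keys f"
  then have m: "Poly_Mapping.keys m \<subseteq> {..e}" "mdegree m = l" using f by (simp_all add: form_def)
  have "form d (\<Sum>i\<in>Poly_Mapping.keys m. k * Poly_Mapping.lookup m i)
      (\<Prod>i\<in>Poly_Mapping.keys m. F i ^ Poly_Mapping.lookup m i)"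
    using m(1) F by (intro form_prod form_power) auto
  then show "form d (k * l) (\<Prod>i\<in>Poly_Mapping.keys m. F i ^ Poly_Mapping.lookup m i)"
    using m(2) by (simp add: mdegree_def sum_distrib_left[symmetric])
qed

lemma continuous_on_peval:
  assumes "\<And>i. continuous_on S (\<lambda>t. c t i)"
  shows "continuous_on S (\<lambda>t. peval f (c t))"
  unfolding peval_def meval_def by (intro continuous_intros assms)

section \<open>Zariski closure and regular maps\<close>

lemma in_closure_zariski_iff:
  assumes "S \<subseteq> proj_space d"
  shows "p \<in> zariski d closure_of S \<longleftrightarrow> p \<in> proj_space d \<and>
    (\<forall>k f. form d k f \<longrightarrow> (\<forall>q\<in>S. \<forall>v\<in>q. peval f v = 0) \<longrightarrow> (\<forall>v\<in>p. peval f v = 0))"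
    (is "_ \<longleftrightarrow> ?R")
proof
  assume p: "p \<in> zariski d closure_of S"
  have "\<forall>v\<in>p. peval f v = 0" if "form d k f" "\<forall>q\<in>S. \<forall>v\<in>q. peval f v = 0" for k f
  proof -
    have "closedin (zariski d) (zero_locus d {f})"
      unfolding closedin_zariski using that(1) by (intro exI[of _ "{f}"]) auto
    moreover have "S \<subseteq> zero_locus d {f}" using assms that(2) by (auto simp: zero_locus_def)
    ultimately have "p \<in> zero_locus d {f}" using closure_of_minimal p by blast
    then show ?thesis by (simp add: zero_locus_def)
  qed
  then show ?R using p closure_of_subset_topspace[of "zariski d" S] topspace_zariski by blast
next
  assume R: ?R
  obtain T where T: "\<forall>f\<in>T. \<exists>k. form d k f" "zariski d closure_of S = zero_locus d T"
    using closedin_closure_of[of "zariski d" S] unfolding closedin_zariski by blast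
  have "S \<subseteq> zero_locus d T"
    using closure_of_subset[of S "zariski d"] assms T(2) by (simp add: topspace_zariski)
  then have "\<forall>f\<in>T. \<forall>v\<in>p. peval f v = 0" using R T(1) unfolding zero_locus_def by blast
  then show "p \<in> zariski d closure_of S" using R T(2) by (simp add: zero_locus_def)
qed

text \<open>A form that vanishes on \<open>A\<close> pulls back along the curve to a continuous function that is nonzero
  at only finitely many parameters. These parameters form an open set, and a finite open set of
  complex numbers is empty.\<close>

lemma limit_in_closure:
  fixes c :: "complex \<Rightarrow> nat \<Rightarrow> complex"
  assumes "A \<subseteq> proj_space d" and cont: "\<And>i. continuous_on UNIV (\<lambda>t. c t i)"
    and nz: "\<exists>i\<le>d. c t i \<noteq> 0" and fin: "finite {s. pt d (c s) \<notin> A}"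
  shows "pt d (c t) \<in> zariski d closure_of A"
proof -
  have "peval f (c t) = 0" if f: "form d k f" and A: "\<forall>q\<in>A. \<forall>v\<in>q. peval f v = 0" for k f
  proof -
    let ?N = "{s. peval f (c s) \<noteq> 0}"
    have "peval f (c s) = 0" if s: "pt d (c s) \<in> A" for s
    proof -
      have "pt d (c s) \<noteq> {}" using s assms(1) proj_class_nonempty by blast
      then obtain v where "v \<in> pt d (c s)" by blast
      then have "\<exists>i\<le>d. c s i \<noteq> 0"
        by (elim mem_ptE) (auto simp: homog_vec_def)
      then show ?thesis using vanishes_pt_iff[OF f] A s by blast
    qed
    then have "?N \<subseteq> {s. pt d (c s) \<notin> A}" by blast
    then have "finite ?N" using fin by (rule finite_subset)
    moreover have "open ?N"
      by (intro open_Collect_neq continuous_on_peval cont continuous_on_const)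
    ultimately have "?N = {}" using finite_imp_not_open by blast
    then show ?thesis by blast
  qed
  then show ?thesis
    unfolding in_closure_zariski_iff[OF assms(1)]
    using vanishes_pt_iff nz pt_in_proj_space by blast
qed

lemma regular_mapE:
  assumes "regular_map d U e f" "p \<in> U"
  obtains V k F where "openin (zariski d) V" "p \<in> V" "\<And>i. i \<le> e \<Longrightarrow> form d k (F i)"
    "\<And>q v. q \<in> U \<Longrightarrow> q \<in> V \<Longrightarrow> v \<in> q \<Longrightarrow>
      (\<exists>i\<le>e. peval (F i) v \<noteq> 0) \<and> f q = pt e (\<lambda>i. peval (F i) v)"
proof -
  have "\<exists>V k F. openin (zariski d) V \<and> p \<in> V \<and> (\<forall>i\<le>e. form d k (F i)) \<and>
      (\<forall>q\<in>U \<inter> V. \<forall>v\<in>q. (\<exists>i\<le>e. peval (F i) v \<noteq> 0) \<and> f q = pt e (\<lambda>i. peval (F i) v))"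
    using assms unfolding regular_map_def by (elim conjE) (erule bspec)
  then show thesis by (elim exE conjE) (rule that, auto)
qed

lemma regular_map_subset:
  assumes "regular_map d U e f" "W \<subseteq> U"
  shows "regular_map d W e f"
  unfolding regular_map_def
proof (intro conjI ballI)
  show "W \<subseteq> proj_space d" using assms by (auto simp: regular_map_def)
  fix p assume "p \<in> W"
  then have "p \<in> U" using assms(2) by blast
  with assms(1) show "\<exists>V k F. openin (zariski d) V \<and> p \<in> V \<and> (\<forall>i\<le>e. form d k (F i)) \<and>
      (\<forall>q\<in>W \<inter> V. \<forall>v\<in>q. (\<exists>i\<le>e. peval (F i) v \<noteq> 0) \<and> f q = pt e (\<lambda>i. peval (F i) v))"
  proof (rule regular_mapE)
    fix V k F
    assume "openin (zariski d) V" "p \<in> V" "\<And>i. i \<le> e \<Longrightarrow> form d k (F i)"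
      "\<And>q v. q \<in> U \<Longrightarrow> q \<in> V \<Longrightarrow> v \<in> q \<Longrightarrow>
        (\<exists>i\<le>e. peval (F i) v \<noteq> 0) \<and> f q = pt e (\<lambda>i. peval (F i) v)"
    then show ?thesis
      using assms(2) by (intro exI[of _ V] exI[of _ k] exI[of _ F]) blast
  qed
qed

text \<open>This is Zariski continuity of a regular map. Near \<open>p\<close> the map is given by forms \<open>F\<close>, so a form
  that vanishes on the image of \<open>B\<close> pulls back to a form, but it is known to vanish only on the
  part of \<open>B\<close> near \<open>p\<close>. Multiplication by a form \<open>h\<close> that vanishes away from that neighbourhood and
  not at \<open>p\<close> extends this to all of \<open>B\<close>.\<close>

lemma regular_map_closure:
  assumes reg: "regular_map d U e f" and "B \<subseteq> U" "p \<in> U" "p \<in> zariski d closure_of B"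
  shows "f p \<in> zariski e closure_of (f ` B)"
proof -
  have U: "U \<subseteq> proj_space d" using reg by (simp add: regular_map_def)
  obtain V k F where V: "openin (zariski d) V" "p \<in> V" and F: "\<And>i. i \<le> e \<Longrightarrow> form d k (F i)"
    and fF: "\<And>q v. q \<in> U \<Longrightarrow> q \<in> V \<Longrightarrow> v \<in> q \<Longrightarrow>
      (\<exists>i\<le>e. peval (F i) v \<noteq> 0) \<and> f q = pt e (\<lambda>i. peval (F i) v)"
    by (rule regular_mapE[OF reg \<open>p \<in> U\<close>]) (rule that)
  have ne: "q \<noteq> {}" if "q \<in> U" for q using U that proj_class_nonempty by blast
  have fU: "f q \<in> proj_space e" if "q \<in> U" for q
  proof -
    obtain V k F where V: "q \<in> V" and F: "\<And>q v. q \<in> U \<Longrightarrow> q \<in> V \<Longrightarrow> v \<in> q \<Longrightarrow>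
      (\<exists>i\<le>e. peval (F i) v \<noteq> 0) \<and> f q = pt e (\<lambda>i. peval (F i) v)"
      by (rule regular_mapE[OF reg \<open>q \<in> U\<close>]) (rule that)
    obtain v where "v \<in> q" using ne \<open>q \<in> U\<close> by blast
    then show ?thesis using F[OF \<open>q \<in> U\<close> V] pt_in_proj_space[of e "\<lambda>i. peval (F i) v"] by simp
  qed
  obtain v where v: "v \<in> p" using ne \<open>p \<in> U\<close> by blast
  obtain S where S: "\<forall>h\<in>S. \<exists>l. form d l h" "V = proj_space d - zero_locus d S"
    using V(1) unfolding openin_zariski by blast
  obtain h w l where h: "h \<in> S" "w \<in> p" "peval h w \<noteq> 0" "form d l h"
    using V(2) S \<open>p \<in> U\<close> U by (auto simp: zero_locus_def)
  have hv: "peval h v \<noteq> 0"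
    using form_vanish_iff[OF h(4) _ v h(2)] h(3) \<open>p \<in> U\<close> U by blast
  have "\<forall>u\<in>f p. peval g u = 0"
    if g: "form e j g" and van: "\<forall>q\<in>f ` B. \<forall>u\<in>q. peval g u = 0" for j g
  proof -
    let ?G = "poly_subst g F"
    have G: "form d (l + k * j) (h * ?G)"
      using form_mult[OF h(4) form_poly_subst[OF g F]] .
    have "peval (h * ?G) u = 0" if q: "q \<in> B" "u \<in> q" for q u
    proof (cases "q \<in> V")
      case True
      then have "\<exists>i\<le>e. peval (F i) u \<noteq> 0" "f q = pt e (\<lambda>i. peval (F i) u)"
        using fF[OF _ True q(2)] q(1) \<open>B \<subseteq> U\<close> by auto
      then have "peval g (\<lambda>i. peval (F i) u) = 0"
        using vanishes_pt_iff[OF g, of "\<lambda>i. peval (F i) u"] van q(1) by auto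
      then show ?thesis by (simp add: peval_mult peval_poly_subst)
    next
      case False
      then have "peval h u = 0"
        using S(2) q \<open>B \<subseteq> U\<close> U h(1) by (auto simp: zero_locus_def)
      then show ?thesis by (simp add: peval_mult)
    qed
    then have "\<forall>q\<in>B. \<forall>u\<in>q. peval (h * ?G) u = 0" by blast
    then have "peval (h * ?G) v = 0"
      using assms(4) G v in_closure_zariski_iff[of B d p] \<open>B \<subseteq> U\<close> U by fast
    then have "peval g (\<lambda>i. peval (F i) v) = 0"
      using hv by (simp add: peval_mult peval_poly_subst)
    moreover have "\<exists>i\<le>e. peval (F i) v \<noteq> 0" "f p = pt e (\<lambda>i. peval (F i) v)"
      using fF[OF \<open>p \<in> U\<close> V(2) v] by simp_all
    ultimately show ?thesis using vanishes_pt_iff[OF g, of "\<lambda>i. peval (F i) v"] by simp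
  qed
  moreover have fB: "f ` B \<subseteq> proj_space e" using fU \<open>B \<subseteq> U\<close> by blast
  ultimately show ?thesis unfolding in_closure_zariski_iff[OF fB] using fU \<open>p \<in> U\<close> by simp
qed

section \<open>Coordinatewise inversion on the torus\<close>

lemma torusE:
  assumes "p \<in> torus d"
  obtains m where "p = pt d m" "\<forall>i\<le>d. m i \<noteq> 0"
proof -
  have p: "p \<in> proj_space d" using assms by (simp add: torus_def)
  then obtain v where v: "v \<in> p" using proj_class_nonempty by blast
  show thesis
    by (rule that[OF proj_space_rep(1)[OF p v]]) (use assms v in \<open>simp add: torus_def\<close>)
qed

lemma psi_torus:
  assumes "p \<in> torus d"
  shows "psi d p \<in> torus d" "psi d (psi d p) = p"
proof -
  obtain m where m: "p = pt d m" "\<forall>i\<le>d. m i \<noteq> 0" using assms by (rule torusE)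
  have "\<forall>i\<le>d. inverse (m i) \<noteq> 0" using m(2) by simp
  then show "psi d p \<in> torus d" "psi d (psi d p) = p"
    by (simp_all add: m(1) psi_pt[OF m(2)] psi_pt)
qed

lemma openin_torus: "openin (zariski d) (torus d)"
proof -
  let ?f = "\<Prod>j\<le>d. poly_var j"
  have "form d (\<Sum>j\<le>d. 1) ?f" by (intro form_prod form_poly_var) simp
  moreover have "torus d = proj_space d - zero_locus d {?f}"
  proof -
    have f: "peval ?f v = 0 \<longleftrightarrow> (\<exists>i\<le>d. v i = 0)" for v
      by (auto simp: peval_prod)
    have "p \<in> torus d \<longleftrightarrow> p \<notin> zero_locus d {?f}" if p: "p \<in> proj_space d" for p
    proof -
      obtain v where v: "v \<in> p" using proj_class_nonempty[OF p] by blast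
      have "peval ?f w = 0 \<longleftrightarrow> peval ?f v = 0" if "w \<in> p" for w
        using form_vanish_iff[OF \<open>form d _ ?f\<close> p that v] .
      then have "p \<in> torus d \<longleftrightarrow> peval ?f v \<noteq> 0" "p \<in> zero_locus d {?f} \<longleftrightarrow> peval ?f v = 0"
        unfolding torus_def zero_locus_def using p v f by blast+
      then show ?thesis by simp
    qed
    moreover have "torus d \<subseteq> proj_space d" by (auto simp: torus_def)
    ultimately show ?thesis by blast
  qed
  ultimately show ?thesis unfolding openin_zariski by blast
qed

text \<open>Multiplication by the product of all coordinates clears the denominators: the inverse of \<open>v\<^sub>i\<close>
  becomes the product of the other coordinates.\<close>

lemma regular_map_psi: "regular_map d (torus d) d (psi d)"
  unfolding regular_map_def
proof (intro conjI ballI)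
  show "torus d \<subseteq> proj_space d" by (auto simp: torus_def)
  fix p assume "p \<in> torus d"
  define F where "F i = (\<Prod>j\<in>{..d} - {i}. poly_var j)" for i
  have "\<forall>i\<le>d. form d d (F i)"
  proof (intro allI impI)
    fix i assume "i \<le> d"
    have "form d (\<Sum>j\<in>{..d} - {i}. 1) (F i)"
      unfolding F_def by (intro form_prod form_poly_var) simp
    then show "form d d (F i)" using \<open>i \<le> d\<close> by simp
  qed
  moreover have "\<forall>q\<in>torus d \<inter> torus d. \<forall>v\<in>q.
      (\<exists>i\<le>d. peval (F i) v \<noteq> 0) \<and> psi d q = pt d (\<lambda>i. peval (F i) v)"
  proof (intro ballI)
    fix q v assume q: "q \<in> torus d \<inter> torus d" "v \<in> q"
    then have v: "\<forall>i\<le>d. v i \<noteq> 0" and "q \<in> proj_space d" by (auto simp: torus_def)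
    then have "q = pt d v" using proj_space_rep(1) q(2) by blast
    then have psi: "psi d q = pt d (\<lambda>i. inverse (v i))" using psi_pt(2)[OF v] by simp
    let ?P = "\<Prod>j\<le>d. v j"
    have P: "?P \<noteq> 0" using v by (simp add: prod_zero_iff)
    have F: "peval (F i) v = ?P * inverse (v i)" if "i \<le> d" for i
    proof -
      have "?P = v i * (\<Prod>j\<in>{..d} - {i}. v j)" using that by (intro prod.remove) auto
      then show ?thesis using v that by (simp add: F_def peval_prod)
    qed
    have "peval (F 0) v \<noteq> 0" using F[of 0] P v by simp
    then have nz: "\<exists>i\<le>d. peval (F i) v \<noteq> 0" by blast
    have "\<exists>i\<le>d. inverse (v i) \<noteq> 0" using v by auto
    moreover have "\<exists>c. c \<noteq> 0 \<and> (\<forall>i\<le>d. peval (F i) v = c * inverse (v i))"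
      using F P by (intro exI[of _ ?P]) simp
    ultimately have "pt d (\<lambda>i. inverse (v i)) = pt d (\<lambda>i. peval (F i) v)"
      using pt_eq_iff[of d "\<lambda>i. inverse (v i)" "\<lambda>i. peval (F i) v"] nz by blast
    with nz psi show "(\<exists>i\<le>d. peval (F i) v \<noteq> 0) \<and> psi d q = pt d (\<lambda>i. peval (F i) v)" by simp
  qed
  ultimately show "\<exists>V k F. openin (zariski d) V \<and> p \<in> V \<and> (\<forall>i\<le>d. form d k (F i)) \<and>
      (\<forall>q\<in>torus d \<inter> V. \<forall>v\<in>q.
        (\<exists>i\<le>d. peval (F i) v \<noteq> 0) \<and> psi d q = pt d (\<lambda>i. peval (F i) v))"
    using openin_torus[of d] \<open>p \<in> torus d\<close>
    by (intro exI[of _ "torus d"] exI[of _ d] exI[of _ F] conjI)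
qed

text \<open>By continuity, control of \<open>psi\<close> on a dense subset of \<open>X\<close> inside the torus is enough.\<close>

lemma rational_map_psi:
  assumes "B \<subseteq> torus d"
  defines "X \<equiv> zariski d closure_of B"
  shows "rational_map d X d (zariski d closure_of (psi d ` B)) (torus d \<inter> X) (psi d)"
  unfolding rational_map_def
proof (intro conjI)
  show "openin (subtopology (zariski d) X) (torus d \<inter> X)"
    using openin_torus by (auto simp: openin_subtopology)
  have "B \<subseteq> topspace (zariski d)" using assms(1) by (auto simp: torus_def topspace_zariski)
  then have "B \<subseteq> torus d \<inter> X" using assms(1) closure_of_subset unfolding X_def by blast
  then show "X \<subseteq> zariski d closure_of (torus d \<inter> X)"
    unfolding X_def by (rule closure_of_mono)
  show "regular_map d (torus d \<inter> X) d (psi d)"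
    by (rule regular_map_subset[OF regular_map_psi]) simp
  show "psi d ` (torus d \<inter> X) \<subseteq> zariski d closure_of (psi d ` B)"
    using regular_map_closure[OF regular_map_psi assms(1)] unfolding X_def by blast
qed

text \<open>The inverse rational map is \<open>psi\<close> itself, restricted to the torus part of the closure of the
  image.\<close>

lemma birational_map_psi:
  assumes "B \<subseteq> torus d"
  defines "X \<equiv> zariski d closure_of B" and "Y \<equiv> zariski d closure_of (psi d ` B)"
  shows "birational_map d X d Y (torus d \<inter> X) (psi d)"
proof -
  have "psi d ` psi d ` B = B"
    unfolding image_image using assms(1) psi_torus(2)[of _ d]
    by (simp add: subset_iff cong: image_cong)
  moreover have "psi d ` B \<subseteq> torus d" using assms(1) psi_torus(1) by blast
  ultimately have XY: "rational_map d X d Y (torus d \<inter> X) (psi d)"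
    and YX: "rational_map d Y d X (torus d \<inter> Y) (psi d)"
    unfolding X_def Y_def
    using rational_map_psi[OF assms(1)] rational_map_psi[of "psi d ` B" d] by simp_all
  \<comment> \<open>Both compositions are thus defined on the whole of the respective domain.\<close>
  have "{p \<in> torus d \<inter> X. psi d p \<in> torus d \<inter> Y} = torus d \<inter> X"
    using XY psi_torus(1) unfolding rational_map_def by blast
  moreover have "{q \<in> torus d \<inter> Y. psi d q \<in> torus d \<inter> X} = torus d \<inter> Y"
    using YX psi_torus(1) unfolding rational_map_def by blast
  ultimately show ?thesis
    unfolding birational_map_def
    using XY YX psi_torus(2)
    by (intro conjI exI[of _ "torus d \<inter> Y"] exI[of _ "psi d"]) (auto simp: rational_map_def)
qed

text \<open>The line through any coordinate vector in the direction \<open>(1, \<dots>, 1)\<close> meets each coordinate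
  hyperplane only once, so all but finitely many of its points lie in the torus.\<close>

lemma closure_torus: "zariski d closure_of torus d = proj_space d"
proof
  show "zariski d closure_of torus d \<subseteq> proj_space d"
    using closure_of_subset_topspace[of "zariski d"] topspace_zariski by blast
  show "proj_space d \<subseteq> zariski d closure_of torus d"
  proof
    fix p assume p: "p \<in> proj_space d"
    then obtain v where "v \<in> p" using proj_class_nonempty by blast
    with p have v: "p = pt d v" "\<exists>i\<le>d. v i \<noteq> 0" by (rule proj_space_rep)+
    define c where "c = (\<lambda>t i. v i + t)"
    have "{s. pt d (c s) \<notin> torus d} \<subseteq> (\<lambda>i. - v i) ` {..d}"
    proof
      fix s assume "s \<in> {s. pt d (c s) \<notin> torus d}"
      then obtain i where "i \<le> d" "v i + s = 0" using psi_pt(1)[of d "c s"] by (auto simp: c_def)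
      then show "s \<in> (\<lambda>i. - v i) ` {..d}" by (auto simp: eq_neg_iff_add_eq_0 add.commute)
    qed
    then have "finite {s. pt d (c s) \<notin> torus d}" by (rule finite_subset) simp
    then have "pt d (c 0) \<in> zariski d closure_of torus d"
      by (intro limit_in_closure)
         (use v(2) in \<open>auto simp: c_def torus_def intro!: continuous_intros\<close>)
    then show "p \<in> zariski d closure_of torus d" using v(1) by (simp add: c_def)
  qed
qed

section \<open>Generic local mixtures and Pareto points\<close>

text \<open>For \<open>i = 0\<close> the last condition says \<open>\<xi> \<noteq> 0\<close>. The condition \<open>\<alpha> \<noteq> 0\<close> excludes the Dirac
  parameters, which would correspond to an infinite Pareto parameter \<open>-\<xi>/\<alpha>\<close>.\<close>

definition generic_local_mixtures :: "nat \<Rightarrow> (nat \<Rightarrow> complex) set set" where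
  "generic_local_mixtures d =
    {local_mixture_param d \<xi> \<alpha> |\<xi> \<alpha>. \<alpha> \<noteq> 0 \<and> (\<forall>i\<le>d. \<xi> + of_nat i * \<alpha> \<noteq> 0)}"

lemma local_mixture_param_factor:
  assumes "\<xi> \<noteq> 0"
  shows "local_mixture_param d \<xi> \<alpha> = pt d (\<lambda>i. \<xi> ^ i * (\<xi> + of_nat i * \<alpha>) / \<xi>)"
proof -
  have "(if i = 0 then 1 else \<xi> ^ i + of_nat i * \<alpha> * \<xi> ^ (i - 1))
      = \<xi> ^ i * (\<xi> + of_nat i * \<alpha>) / \<xi>" for i
    using assms by (cases i) (simp_all add: field_simps)
  then show ?thesis unfolding local_mixture_param_def by presburger
qed

lemma local_mixture_param_torus:
  assumes "\<forall>i\<le>d. \<xi> + of_nat i * \<alpha> \<noteq> 0"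
  shows "local_mixture_param d \<xi> \<alpha> \<in> torus d"
    and "\<alpha> \<noteq> 0 \<Longrightarrow> psi d (local_mixture_param d \<xi> \<alpha>) = pareto_param d (- \<xi> / \<alpha>) (inverse \<xi>)"
proof -
  have \<xi>: "\<xi> \<noteq> 0" using assms[rule_format, of 0] by simp
  have nz: "\<forall>i\<le>d. \<xi> ^ i * (\<xi> + of_nat i * \<alpha>) / \<xi> \<noteq> 0" using \<xi> assms by simp
  then show "local_mixture_param d \<xi> \<alpha> \<in> torus d"
    using psi_pt(1) local_mixture_param_factor[OF \<xi>] by simp
  assume \<alpha>: "\<alpha> \<noteq> 0"
  have "inverse (\<xi> ^ i * (\<xi> + of_nat i * \<alpha>) / \<xi>)
      = - \<xi> / \<alpha> / (- \<xi> / \<alpha> - of_nat i) * inverse \<xi> ^ i" if "i \<le> d" for i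
  proof -
    define s where "s = \<xi> + of_nat i * \<alpha>"
    have eq: "- \<xi> / \<alpha> - of_nat i = - s / \<alpha>" using \<alpha> by (simp add: s_def field_simps)
    have "s \<noteq> 0" using assms that by (simp add: s_def)
    then show ?thesis
      unfolding eq s_def[symmetric] using \<alpha> \<xi> by (simp add: power_inverse field_simps)
  qed
  then have "pt d (\<lambda>i. inverse (\<xi> ^ i * (\<xi> + of_nat i * \<alpha>) / \<xi>))
      = pareto_param d (- \<xi> / \<alpha>) (inverse \<xi>)"
    unfolding pareto_param_def pt_def by (auto intro!: arg_cong[where f = "\<lambda>v. proj_rel d `` {v}"])
  then show "psi d (local_mixture_param d \<xi> \<alpha>) = pareto_param d (- \<xi> / \<alpha>) (inverse \<xi>)"
    using psi_pt(2)[OF nz] local_mixture_param_factor[OF \<xi>] by simp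
qed

lemma psi_generic_local_mixtures:
  "psi d ` generic_local_mixtures d =
    {pareto_param d \<alpha> \<xi> |\<alpha> \<xi>. \<alpha> \<notin> of_nat ` {0..d} \<and> \<xi> \<noteq> 0}" (is "?L = ?R")
proof
  show "?L \<subseteq> ?R"
  proof
    fix q assume "q \<in> ?L"
    then obtain \<xi> \<alpha> where *: "\<alpha> \<noteq> 0" "\<forall>i\<le>d. \<xi> + of_nat i * \<alpha> \<noteq> 0"
      "q = psi d (local_mixture_param d \<xi> \<alpha>)"
      unfolding generic_local_mixtures_def by blast
    have "inverse \<xi> \<noteq> 0" using *(2)[rule_format, of 0] by simp
    moreover have "- \<xi> / \<alpha> \<notin> of_nat ` {0..d}"
    proof
      assume "- \<xi> / \<alpha> \<in> of_nat ` {0..d}"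
      then obtain i where i: "i \<le> d" "- \<xi> / \<alpha> = of_nat i" by auto
      have "\<xi> + of_nat i * \<alpha> = 0" unfolding i(2)[symmetric] using *(1) by simp
      with *(2) i(1) show False by blast
    qed
    moreover have "q = pareto_param d (- \<xi> / \<alpha>) (inverse \<xi>)"
      using local_mixture_param_torus(2)[OF *(2,1)] *(3) by simp
    ultimately show "q \<in> ?R"
      by (intro CollectI exI[of _ "- \<xi> / \<alpha>"] exI[of _ "inverse \<xi>"] conjI)
  qed
  show "?R \<subseteq> ?L"
  proof
    fix q assume "q \<in> ?R"
    then obtain \<alpha> \<xi> where *: "\<alpha> \<notin> of_nat ` {0..d}" "\<xi> \<noteq> 0" "q = pareto_param d \<alpha> \<xi>" by blast
    have ne: "\<alpha> \<noteq> of_nat i" if "i \<le> d" for i using *(1) that by auto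
    have \<alpha>: "\<alpha> \<noteq> 0" using ne[of 0] by simp
    \<comment> \<open>The parameters come from solving \<open>\<alpha> = -\<xi>'/\<alpha>'\<close> and \<open>\<xi> = 1/\<xi>'\<close> for \<open>\<xi>'\<close> and \<open>\<alpha>'\<close>.\<close>
    define \<xi>' \<alpha>' where "\<xi>' = inverse \<xi>" and "\<alpha>' = - inverse (\<alpha> * \<xi>)"
    have "\<xi>' + of_nat i * \<alpha>' = (\<alpha> - of_nat i) / (\<alpha> * \<xi>)" for i
      using \<alpha> *(2) by (simp add: \<xi>'_def \<alpha>'_def field_simps)
    then have "\<forall>i\<le>d. \<xi>' + of_nat i * \<alpha>' \<noteq> 0" using ne \<alpha> *(2) by simp
    moreover have "\<alpha>' \<noteq> 0" using \<alpha> *(2) by (simp add: \<alpha>'_def)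
    moreover have "- \<xi>' / \<alpha>' = \<alpha>" "inverse \<xi>' = \<xi>"
      using \<alpha> *(2) by (simp_all add: \<xi>'_def \<alpha>'_def field_simps)
    ultimately have "q = psi d (local_mixture_param d \<xi>' \<alpha>')"
      and "local_mixture_param d \<xi>' \<alpha>' \<in> generic_local_mixtures d"
      using local_mixture_param_torus(2)[of d \<xi>' \<alpha>'] *(3)
      unfolding generic_local_mixtures_def by (simp, blast)
    then show "q \<in> ?L" by (rule image_eqI)
  qed
qed

lemma closure_generic_local_mixtures:
  "zariski d closure_of generic_local_mixtures d = local_mixture_variety d"
proof
  have sub: "generic_local_mixtures d \<subseteq> {local_mixture_param d \<xi> \<alpha> |\<xi> \<alpha>. True}"
    unfolding generic_local_mixtures_def by blast
  then show "zariski d closure_of generic_local_mixtures d \<subseteq> local_mixture_variety d"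
    unfolding local_mixture_variety_def by (rule closure_of_mono)
  have "local_mixture_param d \<xi> \<alpha> \<in> zariski d closure_of generic_local_mixtures d" for \<xi> \<alpha>
  proof -
    \<comment> \<open>The direction \<open>(1, 1)\<close> is transversal to all the lines \<open>\<alpha> = 0\<close> and \<open>\<xi> + i\<alpha> = 0\<close>.\<close>
    define c where "c = (\<lambda>t i. if i = 0 then 1
      else (\<xi> + t) ^ i + of_nat i * (\<alpha> + t) * (\<xi> + t) ^ (i - 1))"
    have c: "pt d (c t) = local_mixture_param d (\<xi> + t) (\<alpha> + t)" for t
      by (simp add: c_def local_mixture_param_def)
    let ?E = "insert (- \<alpha>) ((\<lambda>i. - (\<xi> + of_nat i * \<alpha>) / (1 + of_nat i)) ` {..d})"
    have "{s. pt d (c s) \<notin> generic_local_mixtures d} \<subseteq> ?E"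
    proof
      fix s assume "s \<in> {s. pt d (c s) \<notin> generic_local_mixtures d}"
      then consider "\<alpha> + s = 0" | i where "i \<le> d" "(\<xi> + s) + of_nat i * (\<alpha> + s) = 0"
        unfolding c generic_local_mixtures_def by blast
      then show "s \<in> ?E"
      proof cases
        case 1
        then show ?thesis by (simp add: eq_neg_iff_add_eq_0 add.commute)
      next
        case (2 i)
        have "(1 + of_nat i :: complex) \<noteq> 0"
          by (metis of_nat_Suc of_nat_eq_0_iff nat.distinct(1))
        moreover have "s * (1 + of_nat i) = - (\<xi> + of_nat i * \<alpha>)"
          using 2(2) by (simp add: algebra_simps eq_neg_iff_add_eq_0)
        ultimately have "s = - (\<xi> + of_nat i * \<alpha>) / (1 + of_nat i)" by (simp add: eq_divide_eq)
        then show ?thesis using 2(1) by blast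
      qed
    qed
    then have fin: "finite {s. pt d (c s) \<notin> generic_local_mixtures d}" by (rule finite_subset) simp
    have "continuous_on UNIV (\<lambda>t. c t i)" for i
      by (cases "i = 0") (auto simp: c_def intro!: continuous_intros)
    moreover have "\<exists>i\<le>d. c 0 i \<noteq> 0" by (auto simp: c_def intro!: exI[of _ 0])
    moreover have "generic_local_mixtures d \<subseteq> proj_space d"
      using local_mixture_param_torus(1) by (auto simp: generic_local_mixtures_def torus_def)
    ultimately have "pt d (c 0) \<in> zariski d closure_of generic_local_mixtures d"
      using fin by (intro limit_in_closure)
    then show ?thesis by (simp add: c)
  qed
  then show "local_mixture_variety d \<subseteq> zariski d closure_of generic_local_mixtures d"
    unfolding local_mixture_variety_def by (intro closure_of_minimal closedin_closure_of) blast
qed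

theorem proposition4p1:
  fixes d :: nat
  shows "rational_map d (proj_space d) d (proj_space d) (torus d) (psi d) \<and>
    birational_map d (local_mixture_variety d) d (pareto_variety d)
      (torus d \<inter> local_mixture_variety d) (psi d)"
proof
  have "psi d ` torus d = torus d" using psi_torus by force
  moreover have "torus d \<inter> proj_space d = torus d" by (auto simp: torus_def)
  ultimately show "rational_map d (proj_space d) d (proj_space d) (torus d) (psi d)"
    using rational_map_psi[of "torus d" d] by (simp add: closure_torus)
  have "generic_local_mixtures d \<subseteq> torus d"
    using local_mixture_param_torus(1) by (auto simp: generic_local_mixtures_def)
  then show "birational_map d (local_mixture_variety d) d (pareto_variety d)
      (torus d \<inter> local_mixture_variety d) (psi d)"
    using birational_map_psi[of "generic_local_mixtures d" d]
    by (simp add: closure_generic_local_mixtures psi_generic_local_mixtures pareto_variety_def)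
qed

end
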